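(* The generating functions of the Tribonacci and Tribonacci-Lucas sedenions are, respectively, $$\sum_{n=0}^{\infty}\widehat{T}_n x^n=\frac{\widehat{T}_0+(\widehat{T}_1-\widehat{T}_0)x+\widehat{T}_{-1}x^2}{1-x-x^2-x^3}$$ and $$\sum_{n=0}^{\infty}\widehat{K}_n x^n=\frac{\widehat{K}_0+(\widehat{K}_1-\widehat{K}_0)x+\widehat{K}_{-1}x^2}{1-x-x^2-x^3}.$$
   Context: The Tribonacci numbers are $T_n=T_{n-1}+T_{n-2}+T_{n-3}$ with $T_0=0,T_1=1,T_2=1$, and the Tribonacci-Lucas numbers are $K_n=K_{n-1}+K_{n-2}+K_{n-3}$ with $K_0=3,K_1=1,K_2=3$; both are extended to negative indices so that the recurrences hold for all integers $n$. The sedenions $\mathbb{S}$ are the 16-dimensional real Cayley-Dickson algebra (the double of the octonions) with standard basis $e_0,e_1,\dots,e_{15}$, $e_0=1$ the identity; addition and multiplication by scalars are componentwise. For every integer $n$, $\widehat{T}_n=\sum_{s=0}^{15}T_{n+s}e_s$ and $\widehat{K}_n=\sum_{s=0}^{15}K_{n+s}e_s$. The identities are identities of formal power series in a (central) indeterminate $x$ with coefficients in $\mathbb{S}$; division by $1-x-x^2-x^3$ means multiplication by its inverse in $\mathbb{R}[[x]]$. *)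

theory Defs
  imports Complex_Main "HOL-Computational_Algebra.Formal_Power_Series"
begin

section \<open>Tribonacci and Tribonacci-Lucas numbers on all integers\<close>

function tribonacci :: "int \<Rightarrow> int" where
  "tribonacci n =
    (if n = 0 then 0 else if n = 1 then 1 else if n = 2 then 1
     else if n > 2 then tribonacci (n - 1) + tribonacci (n - 2) + tribonacci (n - 3)
     else tribonacci (n + 3) - tribonacci (n + 2) - tribonacci (n + 1))"
  by auto
termination
  by (relation "measure (\<lambda>n. nat (if n \<ge> 0 then n else 2 - n))") auto

function tribonacci_lucas :: "int \<Rightarrow> int" where
  "tribonacci_lucas n =
    (if n = 0 then 3 else if n = 1 then 1 else if n = 2 then 3
     else if n > 2 then
       tribonacci_lucas (n - 1) + tribonacci_lucas (n - 2) + tribonacci_lucas (n - 3)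
     else tribonacci_lucas (n + 3) - tribonacci_lucas (n + 2) - tribonacci_lucas (n + 1))"
  by auto
termination
  by (relation "measure (\<lambda>n. nat (if n \<ge> 0 then n else 2 - n))") auto

declare tribonacci.simps [simp del] tribonacci_lucas.simps [simp del]

lemma tribonacci_init:
  "tribonacci 0 = 0" "tribonacci 1 = 1" "tribonacci 2 = 1"
  by (simp_all add: tribonacci.simps)

lemma tribonacci_lucas_init:
  "tribonacci_lucas 0 = 3" "tribonacci_lucas 1 = 1" "tribonacci_lucas 2 = 3"
  by (simp_all add: tribonacci_lucas.simps)

lemma tribonacci_rec:
  "tribonacci n = tribonacci (n - 1) + tribonacci (n - 2) + tribonacci (n - 3)"
proof (cases "n > 2")
  case True
  then show ?thesis by (subst tribonacci.simps) simp
next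
  case False
  then have "tribonacci (n - 3) = tribonacci n - tribonacci (n - 1) - tribonacci (n - 2)"
    by (subst tribonacci.simps) (simp add: algebra_simps)
  then show ?thesis by simp
qed

lemma tribonacci_lucas_rec:
  "tribonacci_lucas n =
    tribonacci_lucas (n - 1) + tribonacci_lucas (n - 2) + tribonacci_lucas (n - 3)"
proof (cases "n > 2")
  case True
  then show ?thesis by (subst tribonacci_lucas.simps) simp
next
  case False
  then have "tribonacci_lucas (n - 3) =
      tribonacci_lucas n - tribonacci_lucas (n - 1) - tribonacci_lucas (n - 2)"
    by (subst tribonacci_lucas.simps) (simp add: algebra_simps)
  then show ?thesis by simp
qed

section \<open>The Cayley-Dickson construction\<close>

text \<open>
  Real, not necessarily associative, unital algebras with a conjugation, a dimension
  and a standard basis \<open>cd_basis 0, \<dots>, cd_basis (cd_dim - 1)\<close>.  The axioms are those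
  that doubling preserves; in the instances below the listed elements do form a basis.
\<close>

class cayley_dickson = real_vector + one + times +
  fixes cd_conj :: "'a \<Rightarrow> 'a"
    and cd_dim :: "'a itself \<Rightarrow> nat"
    and cd_basis :: "nat \<Rightarrow> 'a"
  assumes cd_distrib_right: "(x + y) * z = x * z + y * z"
    and cd_distrib_left: "x * (y + z) = x * y + x * z"
    and cd_mult_scaleR_left: "(r *\<^sub>R x) * y = r *\<^sub>R (x * y)"
    and cd_mult_scaleR_right: "x * (r *\<^sub>R y) = r *\<^sub>R (x * y)"
    and cd_mult_1_left: "1 * x = x"
    and cd_mult_1_right: "x * 1 = x"
    and cd_conj_add: "cd_conj (x + y) = cd_conj x + cd_conj y"
    and cd_conj_scaleR: "cd_conj (r *\<^sub>R x) = r *\<^sub>R cd_conj x"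
    and cd_conj_1: "cd_conj 1 = 1"
    and cd_dim_pos: "cd_dim TYPE('a) > 0"
    and cd_basis_0: "cd_basis 0 = 1"

lemma cd_mult_zero_left: "0 * x = (0::'a::cayley_dickson)"
  using cd_mult_scaleR_left[of 0 "0::'a" x] by simp

lemma cd_mult_zero_right: "x * 0 = (0::'a::cayley_dickson)"
  using cd_mult_scaleR_right[of x 0 "0::'a"] by simp

lemma cd_conj_zero: "cd_conj (0::'a::cayley_dickson) = 0"
  using cd_conj_scaleR[of 0 "0::'a"] by simp

instantiation real :: cayley_dickson
begin

definition cd_conj_real :: "real \<Rightarrow> real" where "cd_conj_real x = x"
definition cd_dim_real :: "real itself \<Rightarrow> nat" where "cd_dim_real _ = 1"
definition cd_basis_real :: "nat \<Rightarrow> real" where "cd_basis_real i = (if i = 0 then 1 else 0)"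

instance
  by standard
    (simp_all add: cd_conj_real_def cd_dim_real_def cd_basis_real_def algebra_simps)

end

datatype 'a cd = CD (cd_fst: 'a) (cd_snd: 'a)

lemma cd_eq_iff: "x = y \<longleftrightarrow> cd_fst x = cd_fst y \<and> cd_snd x = cd_snd y"
  by (cases x; cases y) simp

instantiation cd :: (cayley_dickson) cayley_dickson
begin

definition zero_cd :: "'a cd" where
  "0 = CD 0 0"
definition one_cd :: "'a cd" where
  "1 = CD 1 0"
definition plus_cd :: "'a cd \<Rightarrow> 'a cd \<Rightarrow> 'a cd" where
  "x + y = CD (cd_fst x + cd_fst y) (cd_snd x + cd_snd y)"
definition minus_cd :: "'a cd \<Rightarrow> 'a cd \<Rightarrow> 'a cd" where
  "x - y = CD (cd_fst x - cd_fst y) (cd_snd x - cd_snd y)"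
definition uminus_cd :: "'a cd \<Rightarrow> 'a cd" where
  "- x = CD (- cd_fst x) (- cd_snd x)"
definition scaleR_cd :: "real \<Rightarrow> 'a cd \<Rightarrow> 'a cd" where
  "r *\<^sub>R x = CD (r *\<^sub>R cd_fst x) (r *\<^sub>R cd_snd x)"
definition cd_conj_cd :: "'a cd \<Rightarrow> 'a cd" where
  "cd_conj x = CD (cd_conj (cd_fst x)) (- cd_snd x)"
text \<open>The doubling product \<open>(a, b)(c, d) = (a c - d\<^sup>* b, d a + b c\<^sup>*)\<close>.\<close>
definition times_cd :: "'a cd \<Rightarrow> 'a cd \<Rightarrow> 'a cd" where
  "x * y = CD (cd_fst x * cd_fst y - cd_conj (cd_snd y) * cd_snd x)
              (cd_snd y * cd_fst x + cd_snd x * cd_conj (cd_fst y))"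
definition cd_dim_cd :: "'a cd itself \<Rightarrow> nat" where
  "cd_dim_cd _ = 2 * cd_dim TYPE('a)"
definition cd_basis_cd :: "nat \<Rightarrow> 'a cd" where
  "cd_basis i = (if i < cd_dim TYPE('a) then CD (cd_basis i) 0
                 else CD 0 (cd_basis (i - cd_dim TYPE('a))))"

instance
  by standard
    (simp_all add: cd_eq_iff zero_cd_def one_cd_def plus_cd_def minus_cd_def uminus_cd_def
      scaleR_cd_def times_cd_def cd_conj_cd_def cd_dim_cd_def cd_basis_cd_def
      cd_distrib_left cd_distrib_right cd_mult_scaleR_left cd_mult_scaleR_right
      cd_mult_1_left cd_mult_1_right cd_conj_add cd_conj_scaleR cd_conj_1 cd_dim_pos cd_basis_0
      cd_mult_zero_left cd_mult_zero_right cd_conj_zero algebra_simps)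

end

section \<open>Sedenions\<close>

text \<open>Four doublings of the reals.\<close>

type_synonym sedenion = "real cd cd cd cd"

abbreviation sed_e :: "nat \<Rightarrow> sedenion" where
  "sed_e \<equiv> cd_basis"

lemma cd_dim_sedenion: "cd_dim TYPE(sedenion) = 16"
  by (simp add: cd_dim_cd_def cd_dim_real_def)

lemma sed_e_coordinates:
  "(\<Sum>s=0..15. f s *\<^sub>R sed_e s) =
    CD (CD (CD (CD (f 0) (f 1)) (CD (f 2) (f 3))) (CD (CD (f 4) (f 5)) (CD (f 6) (f 7))))
       (CD (CD (CD (f 8) (f 9)) (CD (f 10) (f 11))) (CD (CD (f 12) (f 13)) (CD (f 14) (f 15))))"
  by (simp add: numeral_eq_Suc zero_cd_def plus_cd_def scaleR_cd_def cd_basis_cd_def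
      cd_dim_cd_def cd_dim_real_def cd_basis_real_def)

definition tribonacci_sedenion :: "int \<Rightarrow> sedenion" where
  "tribonacci_sedenion n = (\<Sum>s=0..15. real_of_int (tribonacci (n + int s)) *\<^sub>R sed_e s)"

definition tribonacci_lucas_sedenion :: "int \<Rightarrow> sedenion" where
  "tribonacci_lucas_sedenion n =
    (\<Sum>s=0..15. real_of_int (tribonacci_lucas (n + int s)) *\<^sub>R sed_e s)"

text \<open>
  The canonical embedding of the real power series into the sedenion power series,
  induced by \<open>r \<mapsto> r \<cdot> e\<^sub>0\<close>.  The library's of_real and the powers of
  fps_X need associative coefficients, so polynomials in the central
  indeterminate enter the sedenion series through this embedding.
\<close>

definition sed_fps_of_real :: "real fps \<Rightarrow> sedenion fps" where
  "sed_fps_of_real f = Abs_fps (\<lambda>n. fps_nth f n *\<^sub>R 1)"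

end

theory Submission
  imports Defs
begin

text \<open>
  Multiplying \<open>\<Sum>\<^sub>n S\<^sub>n x\<^sup>n\<close> by \<open>1 - x - x\<^sup>2 - x\<^sup>3\<close> turns the coefficient at \<open>n \<ge> 3\<close> into
  \<open>S\<^sub>n - S\<^bsub>n-1\<^esub> - S\<^bsub>n-2\<^esub> - S\<^bsub>n-3\<^esub>\<close>, which vanishes for every sequence that satisfies the
  Tribonacci recurrence.  What is left is the numerator: its coefficient
  \<open>S\<^sub>2 - S\<^sub>1 - S\<^sub>0\<close> at \<open>x\<^sup>2\<close> is \<open>S\<^bsub>-1\<^esub>\<close>, by the recurrence run one step backwards.  The argument
  uses nothing else about the sequence (\<open>tribonacci_type_generating_function\<close>), and both
  families of sedenions inherit the recurrence from their coordinates.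

  The one delicate point is the division at the end.  Sedenions are not associative, so a
  factor cannot simply be cancelled in the sedenion power series.  Real power series,
  however, have scalar coefficients, and scalars associate with everything: right
  multiplication by embedded real series is an action of the ring of real power series
  (\<open>mult_sed_fps_of_real_assoc\<close>, \<open>mult_sed_fps_of_real_one\<close>), so multiplying by the inverse
  in that ring does undo the multiplication by the denominator.
\<close>

lemma nth_mult_sed_fps_of_real:
  "fps_nth (f * sed_fps_of_real g) n = (\<Sum>i=0..n. fps_nth g (n - i) *\<^sub>R fps_nth f i)"
  by (simp add: fps_mult_nth sed_fps_of_real_def cd_mult_scaleR_right cd_mult_1_right)

text \<open>
  Both sides have the coefficients \<open>\<Sum> g\<^sub>j h\<^sub>k f\<^sub>i\<close> over \<open>i + j + k = n\<close>; only real scalars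
  get regrouped, never a product of sedenions.
\<close>

lemma mult_sed_fps_of_real_assoc:
  "f * sed_fps_of_real g * sed_fps_of_real h = f * sed_fps_of_real (g * h)"
proof (rule fps_ext)
  fix n
  have "fps_nth (f * sed_fps_of_real g * sed_fps_of_real h) n =
      (\<Sum>j=0..n. \<Sum>i=0..j.
        (fps_nth g (j - i) * fps_nth h (n - j)) *\<^sub>R fps_nth f i)"
    by (simp add: nth_mult_sed_fps_of_real scaleR_sum_right mult.commute)
  also have "\<dots> = (\<Sum>j=0..n. \<Sum>i=0..n - j.
        (fps_nth g i * fps_nth h (n - j - i)) *\<^sub>R fps_nth f j)"
    by (rule fps_mult_assoc_lemma)
  also have "\<dots> = fps_nth (f * sed_fps_of_real (g * h)) n"
    unfolding nth_mult_sed_fps_of_real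
    by (simp add: fps_mult_nth scaleR_sum_left)
  finally show "fps_nth (f * sed_fps_of_real g * sed_fps_of_real h) n =
      fps_nth (f * sed_fps_of_real (g * h)) n" .
qed

lemma mult_sed_fps_of_real_diff:
  "f * sed_fps_of_real (g - h) = f * sed_fps_of_real g - f * sed_fps_of_real h"
  by (rule fps_ext) (simp add: nth_mult_sed_fps_of_real scaleR_left_diff_distrib sum_subtractf)

lemma nth_mult_sed_fps_of_real_X_power:
  "fps_nth (f * sed_fps_of_real (fps_X ^ k)) n = (if n < k then 0 else fps_nth f (n - k))"
proof -
  have "fps_nth (f * sed_fps_of_real (fps_X ^ k)) n =
      (\<Sum>i=0..n. if i = n - k \<and> k \<le> n then fps_nth f i else 0)"
    unfolding nth_mult_sed_fps_of_real
    by (rule sum.cong) (auto simp: fps_X_power_nth)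
  also have "\<dots> = (if n < k then 0 else fps_nth f (n - k))"
    by (cases "k \<le> n") auto
  finally show ?thesis .
qed

lemma nth_mult_sed_fps_of_real_X:
  "fps_nth (f * sed_fps_of_real fps_X) n = (if n = 0 then 0 else fps_nth f (n - 1))"
  using nth_mult_sed_fps_of_real_X_power[of f 1 n] by simp

lemma mult_sed_fps_of_real_one: "f * sed_fps_of_real 1 = f"
  using nth_mult_sed_fps_of_real_X_power[of f 0] by (intro fps_ext) simp

lemma eq_mult_sed_fps_of_real_inverse:
  assumes "f * sed_fps_of_real d = p" and "fps_nth d 0 \<noteq> 0"
  shows "f = p * sed_fps_of_real (inverse d)"
proof -
  have "p * sed_fps_of_real (inverse d) = f * sed_fps_of_real (d * inverse d)"
    by (simp flip: assms(1) add: mult_sed_fps_of_real_assoc)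
  also have "\<dots> = f"
    using assms(2) by (simp add: inverse_mult_eq_1' mult_sed_fps_of_real_one)
  finally show ?thesis by simp
qed

lemma tribonacci_type_generating_function:
  fixes S :: "int \<Rightarrow> sedenion"
  assumes rec: "\<And>n. S n = S (n - 1) + S (n - 2) + S (n - 3)"
  shows "Abs_fps (\<lambda>n. S (int n)) =
    (fps_const (S 0) + fps_const (S 1 - S 0) * sed_fps_of_real fps_X
      + fps_const (S (- 1)) * sed_fps_of_real (fps_X ^ 2))
    * sed_fps_of_real (inverse (1 - fps_X - fps_X ^ 2 - fps_X ^ 3))"
proof (rule eq_mult_sed_fps_of_real_inverse)
  let ?F = "Abs_fps (\<lambda>n. S (int n))"
  let ?N = "fps_const (S 0) + fps_const (S 1 - S 0) * sed_fps_of_real fps_X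
      + fps_const (S (- 1)) * sed_fps_of_real (fps_X ^ 2)"
  show "?F * sed_fps_of_real (1 - fps_X - fps_X ^ 2 - fps_X ^ 3) = ?N"
  proof (rule fps_ext)
    fix n :: nat
    have lhs: "fps_nth (?F * sed_fps_of_real (1 - fps_X - fps_X ^ 2 - fps_X ^ 3)) n =
        S (int n) - (if n = 0 then 0 else S (int (n - 1)))
          - (if n < 2 then 0 else S (int (n - 2))) - (if n < 3 then 0 else S (int (n - 3)))"
      by (simp only: mult_sed_fps_of_real_diff mult_sed_fps_of_real_one fps_sub_nth
          nth_mult_sed_fps_of_real_X nth_mult_sed_fps_of_real_X_power fps_nth_Abs_fps)
    have rhs: "fps_nth ?N n = (if n = 0 then S 0 else 0)
        + (if n = 0 then 0 else if n - 1 = 0 then S 1 - S 0 else 0)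
        + (if n < 2 then 0 else if n - 2 = 0 then S (- 1) else 0)"
      by (simp only: fps_add_nth nth_mult_sed_fps_of_real_X nth_mult_sed_fps_of_real_X_power
          fps_nth_fps_const)
    consider "n = 0" | "n = 1" | "n = 2" | "n \<ge> 3" by linarith
    then show "fps_nth (?F * sed_fps_of_real (1 - fps_X - fps_X ^ 2 - fps_X ^ 3)) n =
        fps_nth ?N n"
    proof cases
      case 3
      with rec[of 2] show ?thesis unfolding lhs rhs by simp
    next
      case 4
      with rec[of "int n"] show ?thesis unfolding lhs rhs by (simp add: of_nat_diff)
    qed (unfold lhs rhs, simp_all)
  qed
qed simp

lemma tribonacci_sedenion_rec:
  "tribonacci_sedenion n =
    tribonacci_sedenion (n - 1) + tribonacci_sedenion (n - 2) + tribonacci_sedenion (n - 3)"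
proof -
  have "tribonacci (n + int s) =
      tribonacci (n - 1 + int s) + tribonacci (n - 2 + int s) + tribonacci (n - 3 + int s)" for s
    using tribonacci_rec[of "n + int s"] by (simp add: algebra_simps)
  then show ?thesis
    unfolding tribonacci_sedenion_def
    by (simp only: of_int_add scaleR_left_distrib sum.distrib)
qed

lemma tribonacci_lucas_sedenion_rec:
  "tribonacci_lucas_sedenion n =
    tribonacci_lucas_sedenion (n - 1) + tribonacci_lucas_sedenion (n - 2)
      + tribonacci_lucas_sedenion (n - 3)"
proof -
  have "tribonacci_lucas (n + int s) =
      tribonacci_lucas (n - 1 + int s) + tribonacci_lucas (n - 2 + int s)
        + tribonacci_lucas (n - 3 + int s)" for s
    using tribonacci_lucas_rec[of "n + int s"] by (simp add: algebra_simps)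
  then show ?thesis
    unfolding tribonacci_lucas_sedenion_def
    by (simp only: of_int_add scaleR_left_distrib sum.distrib)
qed

theorem theorem2p3:
  shows "(Abs_fps (\<lambda>n. tribonacci_sedenion (int n)) =
      (fps_const (tribonacci_sedenion 0)
        + fps_const (tribonacci_sedenion 1 - tribonacci_sedenion 0) * sed_fps_of_real fps_X
        + fps_const (tribonacci_sedenion (- 1)) * sed_fps_of_real (fps_X ^ 2))
      * sed_fps_of_real (inverse (1 - fps_X - fps_X ^ 2 - fps_X ^ 3)))
    \<and> (Abs_fps (\<lambda>n. tribonacci_lucas_sedenion (int n)) =
      (fps_const (tribonacci_lucas_sedenion 0)
        + fps_const (tribonacci_lucas_sedenion 1 - tribonacci_lucas_sedenion 0)
            * sed_fps_of_real fps_X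
        + fps_const (tribonacci_lucas_sedenion (- 1)) * sed_fps_of_real (fps_X ^ 2))
      * sed_fps_of_real (inverse (1 - fps_X - fps_X ^ 2 - fps_X ^ 3)))"
  by (intro conjI tribonacci_type_generating_function tribonacci_sedenion_rec
      tribonacci_lucas_sedenion_rec)

end
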